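(* Let $\lambda\in\mathbb{R}$ with $\lambda\neq 0$, let $a\in\mathbb{R}$ with $a\ne 0$ and $|\lambda a|<1$, and let $m\in\mathbb{N}$ (so $m\ge 1$). Then for every $t\in\mathbb{R}$ with $\sin_{\lambda}(2mt:a)\neq 0$ (so that the left-hand side below is defined) and $\cos_{\lambda}\big(t+\frac{j\pi}{2m\log e_{\lambda}(a)}:a\big)\ne 0$ for all $0\le j\le 2m-1$ (so that the right-hand side is defined), $$-2m\cot_{\lambda}\big(2mt:a\big)=\sum_{j=0}^{2m-1}\tan_{\lambda}\bigg(t+\frac{j\pi}{2m \log e_{\lambda}(a)}:a\bigg).$$
   Context: For nonzero $\lambda\in\mathbb{R}$, $a\in\mathbb{R}$ with $|\lambda a|<1$, and $z\in\mathbb{C}$, the degenerate exponential is $$e_{\lambda}^{z}(a)=\sum_{n=0}^{\infty}(z)_{n,\lambda}\frac{a^{n}}{n!},\qquad (z)_{0,\lambda}=1,\quad (z)_{n,\lambda}=z(z-\lambda)(z-2\lambda)\cdots(z-(n-1)\lambda)\ (n\ge 1),$$ and $e_{\lambda}(a)=e_{\lambda}^{1}(a)$, which is a positive real number; $\log$ is the real natural logarithm. With $i=\sqrt{-1}$ and $x\in\mathbb{R}$, the degenerate cosine and sine are $$\cos_{\lambda}(x:a)=\frac{e_{\lambda}^{xi}(a)+e_{\lambda}^{-xi}(a)}{2},\qquad \sin_{\lambda}(x:a)=\frac{e_{\lambda}^{xi}(a)-e_{\lambda}^{-xi}(a)}{2i}.$$ The degenerate tangent and cotangent are $\tan_{\lambda}(x:a)=\frac{\sin_{\lambda}(x:a)}{\cos_{\lambda}(x:a)}$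 and $\cot_{\lambda}(x:a)=\frac{\cos_{\lambda}(x:a)}{\sin_{\lambda}(x:a)}$, wherever the denominator is nonzero. *)

theory Defs
  imports "HOL-Analysis.Analysis"
begin

definition degenerate_falling :: "real \<Rightarrow> complex \<Rightarrow> nat \<Rightarrow> complex" where
  "degenerate_falling l z n = (\<Prod>k<n. z - of_nat k * of_real l)"

text \<open>Intended for \<open>l \<noteq> 0\<close> and \<open>\<bar>l * a\<bar> < 1\<close>, where the series converges for every \<open>z\<close>
  (lemma \<open>degenerate_exp_sums\<close>).\<close>

definition degenerate_exp :: "real \<Rightarrow> complex \<Rightarrow> real \<Rightarrow> complex" where
  "degenerate_exp l z a = (\<Sum>n. degenerate_falling l z n * (of_real a ^ n / fact n))"

text \<open>The number \<open>degenerate_exp l 1 a\<close> is a positive real (lemma \<open>degenerate_exp_1_real\<close>), so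
  taking its real part only changes its type.\<close>

definition degenerate_e :: "real \<Rightarrow> real \<Rightarrow> real" where
  "degenerate_e l a = Re (degenerate_exp l 1 a)"

definition degenerate_cos :: "real \<Rightarrow> real \<Rightarrow> real \<Rightarrow> complex" where
  "degenerate_cos l x a =
     (degenerate_exp l (of_real x * \<i>) a + degenerate_exp l (- of_real x * \<i>) a) / 2"

definition degenerate_sin :: "real \<Rightarrow> real \<Rightarrow> real \<Rightarrow> complex" where
  "degenerate_sin l x a =
     (degenerate_exp l (of_real x * \<i>) a - degenerate_exp l (- of_real x * \<i>) a) / (2 * \<i>)"

definition degenerate_tan :: "real \<Rightarrow> real \<Rightarrow> real \<Rightarrow> complex" where
  "degenerate_tan l x a = degenerate_sin l x a / degenerate_cos l x a"

definition degenerate_cot :: "real \<Rightarrow> real \<Rightarrow> real \<Rightarrow> complex" where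
  "degenerate_cot l x a = degenerate_cos l x a / degenerate_sin l x a"

lemma degenerate_exp_sums:
  assumes "l \<noteq> 0" and "\<bar>l * a\<bar> < 1"
  shows "(\<lambda>n. degenerate_falling l z n * (of_real a ^ n / fact n)) sums
           ((1 + of_real (l * a)) powr (z / of_real l))"
proof -
  have "degenerate_falling l z n * (of_real a ^ n / fact n) =
          ((z / of_real l) gchoose n) * of_real (l * a) ^ n" for n
  proof -
    have "degenerate_falling l z n = (\<Prod>k<n. of_real l * (z / of_real l - of_nat k))"
      unfolding degenerate_falling_def using assms(1)
      by (intro prod.cong) (auto simp: field_simps)
    also have "\<dots> = of_real l ^ n * (\<Prod>k<n. z / of_real l - of_nat k)"
      by (simp add: prod.distrib)
    finally show ?thesis
      by (simp add: gbinomial_prod_rev atLeast0LessThan power_mult_distrib)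
  qed
  moreover have "norm (complex_of_real (l * a)) < 1"
    using assms(2) by (simp only: norm_of_real)
  ultimately show ?thesis
    using gen_binomial_complex[of "of_real (l * a)" "z / of_real l"] by simp
qed

lemma degenerate_exp_1_real:
  assumes "l \<noteq> 0" and "\<bar>l * a\<bar> < 1"
  shows "degenerate_exp l 1 a = of_real (degenerate_e l a)" and "degenerate_e l a > 0"
proof -
  have pos: "0 < 1 + l * a"
    using assms(2) by linarith
  have "degenerate_exp l 1 a = of_real (1 + l * a) powr of_real (1 / l)"
    using sums_unique[OF degenerate_exp_sums[OF assms, of 1]]
    unfolding degenerate_exp_def by simp
  also have "\<dots> = of_real ((1 + l * a) powr (1 / l))"
    using pos by (intro powr_of_real) simp
  finally have eq: "degenerate_exp l 1 a = of_real ((1 + l * a) powr (1 / l))" .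
  then show "degenerate_exp l 1 a = of_real (degenerate_e l a)"
    by (simp add: degenerate_e_def)
  show "degenerate_e l a > 0"
    unfolding degenerate_e_def eq using pos by simp
qed

end

theory Submission
  imports Defs
begin

text \<open>
  Put \<open>L = ln (1 + l * a) / l\<close>, which is the logarithm of \<open>degenerate_e l a\<close>. The degenerate sine and
  cosine at \<open>x\<close> are \<open>sin (x * L)\<close> and \<open>cos (x * L)\<close>, so with \<open>\<theta> = t * L\<close> the claim is the classical
  evaluation of \<open>tan\<close> summed over \<open>\<theta> + j * pi / n\<close> for the even number \<open>n = 2 * m\<close>. Since
  \<open>tan \<phi> = - \<i> * (1 - 2 / (1 + cis (2 * \<phi>)))\<close>, it follows from the partial fraction decomposition
  of \<open>n / (1 - u ^ n)\<close> over the \<open>n\<close>-th roots of unity, taken at \<open>u = - cis (2 * \<theta>)\<close>.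
\<close>

text \<open>Exchanging the exponents \<open>j\<close> and \<open>k\<close> makes the sum geometric.
  For nonzero \<open>k\<close> its ratio is an \<open>n\<close>-th root of unity other than 1, so it
  vanishes.\<close>

lemma sum_powers_roots_unity:
  assumes "k < n"
  shows "(\<Sum>j<n. cis (2 * pi * real j / real n) ^ k) = (if k = 0 then of_nat n else 0)"
proof (cases "k = 0")
  case False
  define w where "w = cis (2 * pi * real k / real n)"
  \<comment> \<open>Injectivity separates the root at index \<open>k\<close> from the root at index
    0, which is 1.\<close>
  have "inj_on (\<lambda>k. cis (2 * pi * real k / real n)) {..<n}"
    using Complex.bij_betw_roots_unity[of n] assms by (auto simp: bij_betw_def)
  then have "w \<noteq> 1"
    using inj_onD[of _ "{..<n}" k 0] assms False by (fastforce simp: w_def)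
  moreover have "w ^ n = 1"
    using assms cis_multiple_2pi[of "real k"] by (simp add: w_def Complex.DeMoivre)
  moreover have "cis (2 * pi * real j / real n) ^ k = w ^ j" for j
    by (simp add: w_def Complex.DeMoivre mult_ac)
  ultimately show ?thesis
    using False by (simp add: sum_gp_strict)
qed simp

lemma sum_inverse_one_minus_roots_unity:
  fixes u :: complex
  assumes "u ^ n \<noteq> 1"
  shows "(\<Sum>j<n. 1 / (1 - u * cis (2 * pi * real j / real n))) = of_nat n / (1 - u ^ n)"
proof -
  have n: "n > 0"
    using assms by (cases n) auto
  define r where "r j = cis (2 * pi * real j / real n)" for j
  have pow: "(u * r j) ^ n = u ^ n" for j
  proof -
    have "r j ^ n = cis (2 * pi * real j)"
      using n by (simp add: r_def Complex.DeMoivre)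
    then show ?thesis
      by (simp add: power_mult_distrib cis_multiple_2pi)
  qed
  \<comment> \<open>If \<open>u * r j\<close> were 1, then \<open>u ^ n\<close> would be 1 as well.
    Hence the finite geometric sum formula applies, with the same numerator \<open>1 - u ^ n\<close>
    for every \<open>j\<close>.\<close>
  have "1 / (1 - u * r j) = (\<Sum>k<n. (u * r j) ^ k) / (1 - u ^ n)" for j
    using assms pow[of j] by (auto simp: sum_gp_strict)
  then have "(\<Sum>j<n. 1 / (1 - u * r j)) = (\<Sum>j<n. \<Sum>k<n. u ^ k * r j ^ k) / (1 - u ^ n)"
    by (simp add: sum_divide_distrib power_mult_distrib)
  also have "(\<Sum>j<n. \<Sum>k<n. u ^ k * r j ^ k) = (\<Sum>k<n. u ^ k * (\<Sum>j<n. r j ^ k))"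
    unfolding sum_distrib_left by (rule sum.swap)
  also have "\<dots> = (\<Sum>k<n. if k = 0 then of_nat n else 0)"
    by (intro sum.cong) (auto simp: r_def sum_powers_roots_unity)
  also have "\<dots> = of_nat n"
    using n by simp
  finally show ?thesis
    by (simp add: r_def)
qed

lemma of_real_cos_conv_cis: "complex_of_real (cos x) = (cis x + cis (- x)) / 2"
  by (simp add: complex_eq_iff)

lemma of_real_sin_conv_cis: "complex_of_real (sin x) = (cis x - cis (- x)) / (2 * \<i>)"
  by (simp add: complex_eq_iff Re_divide Im_divide power2_eq_square)

text \<open>Half-angle factorisation: pulling out \<open>cis x\<close> leaves
  \<open>cis x - cis (- x)\<close>. In the quotient with its companion for
  \<open>cis (2 * x) + 1\<close>, the factor \<open>2 * cis x\<close> cancels, leaving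
  \<open>\<i> * tan x\<close>.\<close>

lemma cis_double_minus_one: "cis (2 * x) - 1 = 2 * \<i> * cis x * of_real (sin x)"
proof -
  have "cis (2 * x) = cis x * cis x" "cis x * cis (- x) = 1"
    by (simp_all add: cis_mult)
  then show ?thesis
    by (simp add: of_real_sin_conv_cis field_simps)
qed

lemma cis_double_plus_one: "cis (2 * x) + 1 = 2 * cis x * of_real (cos x)"
proof -
  have "cis (2 * x) = cis x * cis x" "cis x * cis (- x) = 1"
    by (simp_all add: cis_mult)
  then show ?thesis
    by (simp add: of_real_cos_conv_cis algebra_simps)
qed

lemma of_real_tan_conv_cis:
  assumes "cos x \<noteq> 0"
  shows "complex_of_real (tan x) = - \<i> * (1 - 2 / (1 + cis (2 * x)))"
proof -
  have nz: "1 + cis (2 * x) \<noteq> 0"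
    using assms cis_double_plus_one[of x] by (simp add: add.commute)
  have "complex_of_real (tan x) = - \<i> * ((cis (2 * x) - 1) / (cis (2 * x) + 1))"
    using assms unfolding cis_double_minus_one cis_double_plus_one by (simp add: tan_def)
  also have "\<dots> = - \<i> * (1 - 2 / (1 + cis (2 * x)))"
    using nz by (simp add: field_simps)
  finally show ?thesis .
qed

lemma of_real_cot_conv_cis:
  assumes "sin x \<noteq> 0"
  shows "complex_of_real (cot x) = \<i> * (2 / (cis (2 * x) - 1) + 1)"
proof -
  have nz: "cis (2 * x) - 1 \<noteq> 0"
    using assms cis_double_minus_one[of x] by simp
  have "complex_of_real (cot x) = \<i> * ((cis (2 * x) + 1) / (cis (2 * x) - 1))"
    using assms unfolding cis_double_minus_one cis_double_plus_one by (simp add: cot_def)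
  also have "\<dots> = \<i> * (2 / (cis (2 * x) - 1) + 1)"
    using nz by (simp add: field_simps)
  finally show ?thesis .
qed

lemma sum_tan_equidistant:
  fixes x :: real
  assumes "even n" and sin: "sin (real n * x) \<noteq> 0"
    and cos: "\<And>j. j < n \<Longrightarrow> cos (x + real j * pi / real n) \<noteq> 0"
  shows "(\<Sum>j<n. tan (x + real j * pi / real n)) = - real n * cot (real n * x)"
proof -
  define u where "u = - cis (2 * x)"
  define w where "w = cis (2 * (real n * x))"
  \<comment> \<open>Evenness of \<open>n\<close> removes the sign:
    \<open>(-1) ^ n = 1\<close>.\<close>
  have un: "u ^ n = w"
    using \<open>even n\<close> by (simp add: u_def w_def Complex.DeMoivre mult_ac)
  have w: "w - 1 \<noteq> 0"
    using sin cis_double_minus_one[of "real n * x"] by (simp add: w_def)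
  \<comment> \<open>Doubling the angle turns the shift by \<open>j * pi / n\<close> into
    multiplication by the \<open>j\<close>-th of the \<open>n\<close>-th roots of unity.\<close>
  have "complex_of_real (tan (x + real j * pi / real n)) =
          - \<i> * (1 - 2 * (1 / (1 - u * cis (2 * pi * real j / real n))))" if "j < n" for j
    using of_real_tan_conv_cis[OF cos[OF that]]
    by (simp add: u_def cis_mult distrib_left mult_ac)
  then have "complex_of_real (\<Sum>j<n. tan (x + real j * pi / real n)) =
          (\<Sum>j<n. - \<i> * (1 - 2 * (1 / (1 - u * cis (2 * pi * real j / real n)))))"
    by simp
  also have "\<dots> = - \<i> * (of_nat n - 2 * (of_nat n / (1 - u ^ n)))"
    using sum_inverse_one_minus_roots_unity[of u n] w un
    by (simp only: sum_distrib_left[symmetric] sum_subtractf) simp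
  also have "\<dots> = - of_nat n * (\<i> * (2 / (w - 1) + 1))"
  proof -
    have "1 - w \<noteq> 0" using w by simp
    then show ?thesis using w unfolding un by (simp add: divide_simps) (simp add: algebra_simps)
  qed
  also have "\<dots> = complex_of_real (- real n * cot (real n * x))"
    using of_real_cot_conv_cis[OF sin] by (simp add: w_def)
  finally show ?thesis
    unfolding of_real_eq_iff .
qed

context
  fixes l a :: real
  assumes l: "l \<noteq> 0" and la: "\<bar>l * a\<bar> < 1"
begin

lemma degenerate_exp_eq_powr: "degenerate_exp l z a = of_real (1 + l * a) powr (z / of_real l)"
  using sums_unique[OF degenerate_exp_sums[OF l la]] by (simp add: degenerate_exp_def)

lemma ln_degenerate_e: "ln (degenerate_e l a) = ln (1 + l * a) / l"
proof -
  have "degenerate_exp l 1 a = of_real (1 + l * a) powr of_real (1 / l)"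
    by (simp add: degenerate_exp_eq_powr)
  also have "\<dots> = of_real ((1 + l * a) powr (1 / l))"
    using la by (intro powr_of_real) linarith
  finally show ?thesis
    using la by (simp add: degenerate_e_def ln_powr)
qed

text \<open>As \<open>1 + l * a\<close> is a positive real, the principal logarithm in
  \<open>powr\<close> is the real one, so the exponent \<open>x * \<i> / l\<close> gives a pure
  phase.\<close>

lemma degenerate_exp_imaginary:
  "degenerate_exp l (of_real x * \<i>) a = cis (x * ln (degenerate_e l a))"
proof -
  have pos: "1 + l * a > 0"
    using la by linarith
  then have "complex_of_real (1 + l * a) \<noteq> 0"
    by (metis less_irrefl of_real_eq_0_iff)
  then show ?thesis
    using pos unfolding degenerate_exp_eq_powr ln_degenerate_e powr_def cis_conv_exp
    by (simp add: Ln_of_real mult_ac del: of_real_add of_real_mult)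
       (simp add: mult_ac)
qed

lemma degenerate_cos_eq: "degenerate_cos l x a = of_real (cos (x * ln (degenerate_e l a)))"
  using degenerate_exp_imaginary[of x] degenerate_exp_imaginary[of "- x"]
  by (simp add: degenerate_cos_def of_real_cos_conv_cis)

lemma degenerate_sin_eq: "degenerate_sin l x a = of_real (sin (x * ln (degenerate_e l a)))"
  using degenerate_exp_imaginary[of x] degenerate_exp_imaginary[of "- x"]
  by (simp add: degenerate_sin_def of_real_sin_conv_cis)

text \<open>Where the cosine vanishes, both sides are 0 by the convention for division by zero, so
  the identity holds for every \<open>x\<close>. The same goes for the cotangent where the sine
  vanishes.\<close>

lemma degenerate_tan_eq: "degenerate_tan l x a = of_real (tan (x * ln (degenerate_e l a)))"
  by (simp add: degenerate_tan_def degenerate_sin_eq degenerate_cos_eq tan_def)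

lemma degenerate_cot_eq: "degenerate_cot l x a = of_real (cot (x * ln (degenerate_e l a)))"
  by (simp add: degenerate_cot_def degenerate_sin_eq degenerate_cos_eq cot_def)

end

theorem theorem2p3:
  fixes l a t :: real and m :: nat
  assumes "l \<noteq> 0" and "a \<noteq> 0" and "\<bar>l * a\<bar> < 1" and "m \<ge> 1"
    and "degenerate_sin l (2 * real m * t) a \<noteq> 0"
    and "\<And>j::nat. j \<le> 2 * m - 1 \<Longrightarrow>
           degenerate_cos l (t + real j * pi / (2 * real m * ln (degenerate_e l a))) a \<noteq> 0"
  shows "- (2 * of_nat m) * degenerate_cot l (2 * real m * t) a =
           (\<Sum>j = 0..2 * m - 1.
              degenerate_tan l (t + real j * pi / (2 * real m * ln (degenerate_e l a))) a)"
proof -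
  define L where "L = ln (degenerate_e l a)"
  define n where "n = 2 * m"
  note eqs = degenerate_sin_eq[OF assms(1,3)] degenerate_cos_eq[OF assms(1,3)]
    degenerate_tan_eq[OF assms(1,3)] degenerate_cot_eq[OF assms(1,3)]
  have sin: "sin (real n * (t * L)) \<noteq> 0"
    using assms(5) by (simp add: eqs n_def L_def mult_ac)
  \<comment> \<open>With \<open>L = 0\<close> the sine above would be \<open>sin 0\<close>. Now
    \<open>L\<close> can be cancelled in the shifts.\<close>
  then have "L \<noteq> 0"
    by auto
  then have arg: "(t + real j * pi / (2 * real m * L)) * L = t * L + real j * pi / real n" for j
    by (simp add: n_def distrib_right)
  have "cos (t * L + real j * pi / real n) \<noteq> 0" if "j < n" for j
    using assms(6)[of j] that unfolding eqs L_def[symmetric] arg by (simp add: n_def)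
  then have "(\<Sum>j<n. tan (t * L + real j * pi / real n)) = - real n * cot (real n * (t * L))"
    by (intro sum_tan_equidistant sin) (auto simp: n_def)
  \<comment> \<open>Here \<open>m \<ge> 1\<close> matters: for \<open>m = 0\<close> truncated
    subtraction would make the left side \<open>{0}\<close> and the right side empty.\<close>
  moreover have "{0..2 * m - 1} = {..<n}"
    using assms(4) by (auto simp: n_def)
  ultimately show ?thesis
    unfolding eqs L_def[symmetric] arg of_real_sum[symmetric]
    by (simp add: n_def mult_ac)
qed

end
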